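(* Let $\mu_1,\dots,\mu_r>-1$ be such that $\mu_i-\mu_j\notin\mathbb Z$ if $i\neq j$. Let $\vec n=(n_1,\dots,n_r),\ \vec j=(j_1,\dots,j_r)\in\mathbb N_0^r$ be such that $0\le|\vec j|\le|\vec n|/2$, and let $\nu\in\{1,2\}$ (with $|\vec j|<|\vec n|/2$ if $\nu=2$). Then for $1\le l\le r$ and $a,b\in\mathbb N_0$, $$\int_D \mathbf P^{\vec n}_{\vec j,\nu}(x,y)\,x^ay^b\,W_l(x,y)\,dx\,dy=0\qquad\text{if }0\le a+b<|\vec n|-2|\vec j|+2j_l .$$ Moreover, for $1\le l\le r$, $$\int_D \mathbf P^{\vec n}_{\vec j,\nu}(x,y)\,x^ay^b\,W_l(x,y)\,dx\,dy=0\qquad\text{if }a+b-|\vec n|+2|\vec j|\text{ is odd}.$$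
   Context: For a multi-index $\vec v=(v_1,\dots,v_r)\in\mathbb N_0^r$, $|\vec v|=v_1+\cdots+v_r$. $D=\{(x,y)\in\mathbb R^2:x^2+y^2\le1\}$ is the unit disk, with polar coordinates $x=\rho\cos\theta$, $y=\rho\sin\theta$. Write $\vec\mu=(\mu_1,\dots,\mu_r)$, and $W_l(x,y)=w_{\mu_l}(1-x^2-y^2)^{\mu_l}$ with $w_\mu=(\mu+1)/\pi$. Type II Jacobi–Piñeiro polynomials: for $\alpha>-1$ and $\vec\gamma=(\gamma_1,\dots,\gamma_r)$ with $\gamma_l>-1$ and $\gamma_i-\gamma_j\notin\mathbb Z$ for $i\ne j$, let $\omega_l(t)=t^\alpha(1-t)^{\gamma_l}$ on $[0,1]$. For $\vec k=(k_1,\dots,k_r)\in\mathbb N_0^r$, $P^{(\alpha,\vec\gamma)}_{\vec k}$ is the polynomial of degree $|\vec k|$ (unique up to a nonzero constant factor) with $$\int_0^1P^{(\alpha,\vec\gamma)}_{\vec k}(t)\,t^s\,t^\alpha(1-t)^{\gamma_l}\,dt=0,\qquad 0\le s\le k_l-1,\ 1\le l\le r.$$ The normalization is given by the Rodrigues formula $$P^{(\alpha,\vec\gamma)}_{\vec k}(t)=\Big(\tfrac1{\omega_r(t)}\tfrac{d^{k_r}}{dt^{k_r}}\omega_r(t)(1-t)^{k_r}\Big)\cdots\Big(\tfrac1{\omega_1(t)}\tfrac{d^{k_1}}{dt^{k_1}}\omega_1(t)(1-t)^{k_1}\Big)t^{|\vec k|}$$ (composition of operators). Type II multiple orthogonal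 polynomials on the disk: with $M=|\vec n|-2|\vec j|$, $$\mathbf P^{\vec n}_{\vec j,1}(\rho,\theta)=P^{(M,\vec\mu)}_{\vec j}(\rho^2)\,\rho^{M}\cos(M\theta)\quad(0\le|\vec j|\le|\vec n|/2),$$ $$\mathbf P^{\vec n}_{\vec j,2}(\rho,\theta)=P^{(M,\vec\mu)}_{\vec j}(\rho^2)\,\rho^{M}\sin(M\theta)\quad(0\le|\vec j|<|\vec n|/2).$$ These are polynomials in $(x,y)$ of degree $|\vec n|$. *)

theory Defs
  imports "HOL-Analysis.Analysis" "HOL-Computational_Algebra.Polynomial"
begin

text \<open>
  Multi-indices and parameter vectors of length \<open>r\<close> are functions on \<open>nat\<close>, of which only
  the entries with index in \<open>{1..r}\<close> are used.
\<close>

definition mi_abs :: "nat \<Rightarrow> (nat \<Rightarrow> nat) \<Rightarrow> nat" where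
  "mi_abs r v = (\<Sum>l=1..r. v l)"

definition disk :: "(real \<times> real) set" where
  "disk = {(x, y). x\<^sup>2 + y\<^sup>2 \<le> 1}"

definition disk_weight :: "real \<Rightarrow> real \<Rightarrow> real \<Rightarrow> real" where
  "disk_weight \<mu> x y = (\<mu> + 1) / pi * (1 - x\<^sup>2 - y\<^sup>2) powr \<mu>"

definition jp_weight :: "real \<Rightarrow> real \<Rightarrow> real \<Rightarrow> real" where
  "jp_weight \<alpha> g t = t powr \<alpha> * (1 - t) powr g"

definition is_jacobi_pineiro ::
    "nat \<Rightarrow> real \<Rightarrow> (nat \<Rightarrow> real) \<Rightarrow> (nat \<Rightarrow> nat) \<Rightarrow> real poly \<Rightarrow> bool" where
  "is_jacobi_pineiro r \<alpha> \<gamma> k p \<longleftrightarrow>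
     degree p = mi_abs r k \<and>
     (\<forall>l\<in>{1..r}. \<forall>s<k l.
        (LINT t:{0..1}|lborel. poly p t * t ^ s * jp_weight \<alpha> (\<gamma> l) t) = 0)"

text \<open>
  The operator \<open>f \<mapsto> \<omega>\<^sup>-\<^sup>1 (d/dt)\<^sup>m (\<omega> (1 - t)\<^sup>m f)\<close> with
  \<open>\<omega> = jp_weight \<alpha> g\<close>; it is meaningful only on the open interval \<open>(0,1)\<close>.
\<close>

definition rodrigues_op ::
    "real \<Rightarrow> real \<Rightarrow> nat \<Rightarrow> (real \<Rightarrow> real) \<Rightarrow> real \<Rightarrow> real" where
  "rodrigues_op \<alpha> g m f t =
     (deriv ^^ m) (\<lambda>u. jp_weight \<alpha> g u * (1 - u) ^ m * f u) t / jp_weight \<alpha> g t"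

text \<open>Since \<open>fold\<close> runs from the left, the operator with index \<open>1\<close> acts first.\<close>

definition rodrigues ::
    "nat \<Rightarrow> real \<Rightarrow> (nat \<Rightarrow> real) \<Rightarrow> (nat \<Rightarrow> nat) \<Rightarrow> real \<Rightarrow> real" where
  "rodrigues r \<alpha> \<gamma> k =
     fold (\<lambda>l. rodrigues_op \<alpha> (\<gamma> l) (k l)) [1..<Suc r] (\<lambda>t. t ^ mi_abs r k)"

text \<open>
  The orthogonality relations determine the polynomial up to a nonzero constant factor, which
  is then fixed by the Rodrigues formula.
\<close>

definition jacobi_pineiro ::
    "nat \<Rightarrow> real \<Rightarrow> (nat \<Rightarrow> real) \<Rightarrow> (nat \<Rightarrow> nat) \<Rightarrow> real poly" where
  "jacobi_pineiro r \<alpha> \<gamma> k =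
     (THE p. is_jacobi_pineiro r \<alpha> \<gamma> k p \<and>
             (\<forall>t\<in>{0<..<1}. poly p t = rodrigues r \<alpha> \<gamma> k t))"

text \<open>
  The subtraction below is on natural numbers; it is the intended one when
  \<open>2 * mi_abs r j \<le> mi_abs r n\<close>.
\<close>

definition disk_mop_polar ::
    "nat \<Rightarrow> (nat \<Rightarrow> real) \<Rightarrow> (nat \<Rightarrow> nat) \<Rightarrow> (nat \<Rightarrow> nat) \<Rightarrow> nat \<Rightarrow> real \<Rightarrow> real \<Rightarrow> real" where
  "disk_mop_polar r \<mu> n j \<nu> \<rho> \<theta> =
     (let M = mi_abs r n - 2 * mi_abs r j in
      poly (jacobi_pineiro r (real M) \<mu> j) (\<rho>\<^sup>2) * \<rho> ^ M *
      (if \<nu> = 1 then cos (real M * \<theta>) else sin (real M * \<theta>)))"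

text \<open>
  The choice of the angle does not matter: \<open>M\<close> is an integer, and at the origin the factor
  \<open>\<rho> ^ M\<close> vanishes unless \<open>M = 0\<close>, when the angle does not enter.
\<close>

definition disk_mop ::
    "nat \<Rightarrow> (nat \<Rightarrow> real) \<Rightarrow> (nat \<Rightarrow> nat) \<Rightarrow> (nat \<Rightarrow> nat) \<Rightarrow> nat \<Rightarrow> real \<Rightarrow> real \<Rightarrow> real" where
  "disk_mop r \<mu> n j \<nu> x y =
     disk_mop_polar r \<mu> n j \<nu> (cmod (Complex x y)) (Arg (Complex x y))"

end

theory Submission
  imports Defs
begin

text \<open>
  Each Rodrigues operator is a chain of derivatives of functions \<open>t\<^sup>A (1 - t)\<^sup>B p(t)\<close>, so it
  maps \<open>t\<^sup>K\<close> times a polynomial to a function of the same kind. Integration by parts moves the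
  operator with index \<open>i\<close> to the test function \<open>(1 - t)\<^sup>c q(t)\<close>, \<open>c = \<gamma>\<^sub>l - \<gamma>\<^sub>i\<close>. The result is again
  \<open>(1 - t)\<^sup>c\<close> times a power of \<open>1 - t\<close> and a polynomial of degree at most \<open>degree q\<close>, and it is \<open>0\<close> if
  \<open>l = i\<close> and \<open>degree q < k\<^sub>i\<close>. Hence the orthogonality with respect to one weight, once created,
  survives the later operators, and the Rodrigues formula does define the Jacobi-Pineiro polynomial.

  On the disk, with \<open>z = x + iy\<close>, the polynomial is the real or imaginary part of
  \<open>P(\<bar>z\<bar>\<^sup>2) z\<^sup>M\<close>, and \<open>x\<^sup>a y\<^sup>b\<close> is a combination of the products of \<open>z\<^sup>i\<close> and the \<open>i'\<close>-th power of
  the conjugate of \<open>z\<close> with \<open>i + i' = a + b\<close>. By rotation invariance only the term with \<open>i' = M + i\<close> can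
  contribute. There is none if \<open>a + b - M\<close> is odd; otherwise \<open>i = (a + b - M) / 2\<close>, and the
  radial integral is \<open>\<pi>\<close> times the integral of \<open>P(t) t\<^sup>M t\<^sup>i (1 - t)\<^sup>\<mu>\<close>, which is \<open>0\<close> for \<open>i < j\<^sub>l\<close>.
\<close>

section \<open>Beta integrals and Jacobi-Pineiro polynomials\<close>

text \<open>The parameters are those of the Beta function: the exponents lie one below them, so
  \<open>A > 0\<close> and \<open>B > 0\<close> ensure convergence and the polynomial
  \<open>1\<close> gives \<open>Beta A B\<close>.\<close>

definition beta_integral :: "real \<Rightarrow> real \<Rightarrow> real poly \<Rightarrow> real" where
  "beta_integral A B p = (LINT t:{0<..<1}|lborel. t powr (A - 1) * (1 - t) powr (B - 1) * poly p t)"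

lemma set_borel_measurable_borel:
  fixes f :: "'a::euclidean_space \<Rightarrow> 'b::{second_countable_topology, real_normed_vector}"
  assumes "f \<in> borel_measurable borel" "S \<in> sets borel"
  shows "set_borel_measurable lborel S f"
  using assms unfolding set_borel_measurable_def
  by (auto intro!: borel_measurable_scaleR borel_measurable_indicator)

text \<open>The gauge integral becomes a Lebesgue integral: a nonnegative integrand is absolutely
  integrable, and Borel measurability leads from the completed measure back to
  \<open>lborel\<close>.\<close>

lemma Beta_has_set_integral:
  fixes A B :: real
  assumes "A > 0" "B > 0"
  shows "set_integrable lborel {0<..<1} (\<lambda>t. t powr (A - 1) * (1 - t) powr (B - 1))"
    and "(LINT t:{0<..<1}|lborel. t powr (A - 1) * (1 - t) powr (B - 1)) = Beta A B"
proof -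
  let ?f = "\<lambda>t::real. t powr (A - 1) * (1 - t) powr (B - 1)"
  have I: "(?f has_integral Beta A B) {0<..<1}"
    using has_integral_Beta_real[OF assms] by (simp add: has_integral_Icc_iff_Ioo)
  have "?f absolutely_integrable_on {0<..<1}"
    using I by (intro nonnegative_absolutely_integrable_1) (auto simp: integrable_on_def)
  moreover have M: "(\<lambda>t. indicat_real {0<..<1} t *\<^sub>R ?f t) \<in> borel_measurable lborel"
    by measurable
  ultimately show S: "set_integrable lborel {0<..<1} ?f"
    unfolding set_integrable_def using integrable_completion[OF M] by simp
  show "(LINT t:{0<..<1}|lborel. ?f t) = Beta A B"
    using set_borel_integral_eq_integral(2)[OF S] integral_unique[OF I] by simp
qed

lemma borel_measurable_poly [measurable]: "poly (p :: real poly) \<in> borel_measurable borel"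
  by (intro borel_measurable_continuous_onI continuous_intros)

lemma poly_bounded_unit_interval:
  fixes p :: "real poly"
  shows "\<exists>C. \<forall>t\<in>{0..1}. \<bar>poly p t\<bar> \<le> C"
proof -
  have "compact (poly p ` {0..1})"
    by (intro compact_continuous_image continuous_intros) auto
  then show ?thesis
    using compact_imp_bounded[of "poly p ` {0..1}"] by (auto simp: bounded_iff)
qed

lemma beta_weight_poly_integrable:
  fixes A B :: real and p :: "real poly"
  assumes "A > 0" "B > 0"
  shows "set_integrable lborel {0<..<1} (\<lambda>t. t powr (A - 1) * (1 - t) powr (B - 1) * poly p t)"
proof -
  obtain C where C: "\<And>t. t \<in> {0..1} \<Longrightarrow> \<bar>poly p t\<bar> \<le> C"
    using poly_bounded_unit_interval by blast
  show ?thesis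
  proof (rule set_integrable_bound)
    show "set_integrable lborel {0<..<1} (\<lambda>t. C * (t powr (A - 1) * (1 - t) powr (B - 1)))"
      using Beta_has_set_integral(1)[OF assms] by (rule set_integrable_mult_right)
    show "set_borel_measurable lborel {0<..<1} (\<lambda>t. t powr (A - 1) * (1 - t) powr (B - 1) * poly p t)"
      by (intro set_borel_measurable_borel) measurable
    show "AE t in lborel. t \<in> {0<..<1} \<longrightarrow> norm (t powr (A - 1) * (1 - t) powr (B - 1) * poly p t)
        \<le> norm (C * (t powr (A - 1) * (1 - t) powr (B - 1)))"
    proof (intro AE_I2 impI)
      fix t :: real assume "t \<in> {0<..<1}"
      then have "\<bar>poly p t\<bar> \<le> \<bar>C\<bar>" using C[of t] by auto
      then show "norm (t powr (A - 1) * (1 - t) powr (B - 1) * poly p t)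
        \<le> norm (C * (t powr (A - 1) * (1 - t) powr (B - 1)))"
        by (simp add: abs_mult mult.commute[of _ "poly p t"] mult_right_mono)
    qed
  qed
qed

lemma beta_integral_add:
  "A > 0 \<Longrightarrow> B > 0 \<Longrightarrow> beta_integral A B (p + q) = beta_integral A B p + beta_integral A B q"
  unfolding beta_integral_def
  by (subst set_integral_add(2)[symmetric])
     (auto intro: beta_weight_poly_integrable simp: distrib_left)

lemma beta_integral_smult: "beta_integral A B (smult c p) = c * beta_integral A B p"
  unfolding beta_integral_def
  by (subst set_integral_mult_right[symmetric]) (simp add: mult_ac)

lemma beta_integral_0 [simp]: "beta_integral A B 0 = 0"
  by (simp add: beta_integral_def)

lemma beta_integral_1: "A > 0 \<Longrightarrow> B > 0 \<Longrightarrow> beta_integral A B 1 = Beta A B"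
  by (simp add: beta_integral_def Beta_has_set_integral)

lemma beta_integral_cong:
  assumes "\<And>t. 0 < t \<Longrightarrow> t < 1 \<Longrightarrow> t powr (A - 1) * (1 - t) powr (B - 1) * poly p t =
      t powr (A' - 1) * (1 - t) powr (B' - 1) * poly q t"
  shows "beta_integral A B p = beta_integral A' B' q"
  unfolding beta_integral_def using assms by (intro set_lebesgue_integral_cong) auto

lemma beta_integral_X_mult: "beta_integral A B (pCons 0 p) = beta_integral (A + 1) B p"
  by (rule beta_integral_cong) (simp add: powr_diff powr_add)

section \<open>Weighted derivatives and their adjoints on polynomials\<close>

text \<open>\<open>jstep A B\<close> is differentiation stripped of the weight: the derivative of
  \<open>t\<^sup>A (1 - t)\<^sup>B p(t)\<close> is \<open>t\<^sup>A\<^sup>-\<^sup>1 (1 - t)\<^sup>B\<^sup>-\<^sup>1 (jstep A B p)(t)\<close>.\<close>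

definition jstep :: "real \<Rightarrow> real \<Rightarrow> real poly \<Rightarrow> real poly" where
  "jstep A B p = smult A ([:1, -1:] * p) - smult B (pCons 0 p) + pCons 0 ([:1, -1:] * pderiv p)"

lemma jstep_0 [simp]: "jstep A B 0 = 0"
  by (simp add: jstep_def)

text \<open>A factor t raises the exponent \<open>A\<close> by one.\<close>

lemma jstep_pCons: "jstep A B (pCons c p) = smult c [:A, - (A + B):] + pCons 0 (jstep (A + 1) B p)"
  by (rule poly_eqI)
     (auto simp: jstep_def pderiv_pCons coeff_pCons algebra_simps split: nat.splits)

text \<open>This is the integral of a derivative whose boundary values vanish. Instead of taking
  limits, the proof reduces it, coefficient by coefficient, to
  \<open>(A + B) * Beta (A + 1) B = A * Beta A B\<close>.\<close>

lemma beta_integral_jstep: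
  assumes "A > 0" "B > 0"
  shows "beta_integral A B (jstep A B p) = 0"
  using assms
proof (induction p arbitrary: A)
  case (pCons c p)
  have "[:A, - (A + B):] = smult A 1 + pCons 0 (smult (- (A + B)) 1)"
    by simp
  then have "beta_integral A B [:A, - (A + B):] = A * Beta A B - (A + B) * Beta (A + 1) B"
    using pCons.prems by (simp only: beta_integral_add beta_integral_smult beta_integral_X_mult beta_integral_1 add_pos_pos zero_less_one)
  also have "\<dots> = 0"
    using Beta_plus1_left[of A B] pCons.prems nonpos_Ints_nonpos[of A] by force
  finally show ?case
    using pCons by (simp only: jstep_pCons beta_integral_add beta_integral_smult beta_integral_X_mult)
qed simp

text \<open>\<open>jadj c\<close> describes the adjoint of a step: the derivative of \<open>(1 - t)\<^sup>c q(t)\<close> is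
  \<open>(1 - t)\<^sup>c\<^sup>-\<^sup>1 (jadj c q)(t)\<close>.\<close>

definition jadj :: "real \<Rightarrow> real poly \<Rightarrow> real poly" where
  "jadj c q = [:1, -1:] * pderiv q - smult c q"

text \<open>Product rule for t^A (1-t)^B p and (1-t)^c q, with the common factor t^(A-1)
  (1-t)^(B+c-1) removed; \<open>pCons 0\<close> is the factor t left over in the second
  term.\<close>

lemma jstep_mult: "jstep A (B + c) (p * q) = jstep A B p * q + pCons 0 (p * jadj c q)"
  unfolding jstep_def jadj_def by (simp add: pderiv_mult algebra_simps smult_add_left)

text \<open>Integration by parts; the left-over t is absorbed into the first parameter.\<close>

lemma beta_integral_jstep_mult:
  assumes "A > 0" "B + c > 0"
  shows "beta_integral A (B + c) (jstep A B p * q) = - beta_integral (A + 1) (B + c) (p * jadj c q)"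
  using beta_integral_jstep[OF assms, of "p * q"] assms
  by (simp add: jstep_mult beta_integral_add beta_integral_X_mult)

primrec jsteps :: "real \<Rightarrow> real \<Rightarrow> nat \<Rightarrow> real poly \<Rightarrow> real poly" where
  "jsteps A B 0 p = p"
| "jsteps A B (Suc m) p = jstep (A - real m) (B - real m) (jsteps A B m p)"

text \<open>The signs of the integrations by parts are included: (1-t)^(c-m) times
  \<open>jadjs m c q\<close> is (-1)^m times the m-th derivative of (1-t)^c q.\<close>

primrec jadjs :: "nat \<Rightarrow> real \<Rightarrow> real poly \<Rightarrow> real poly" where
  "jadjs 0 c q = q"
| "jadjs (Suc m) c q = - jadjs m (c - 1) (jadj c q)"

text \<open>Integration by parts, \<open>m\<close> times, the outermost derivative first. Each one
  raises the exponent \<open>B - m\<close> and lowers \<open>c\<close> by one, so the second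
  parameter is the same on both sides.\<close>

lemma beta_integral_jsteps_mult:
  assumes "A + 1 > real m" "B + c + 1 > real m"
  shows "beta_integral (A + 1 - real m) (B + c + 1 - real m) (jsteps A B m p * q) =
         beta_integral (A + 1) (B + c + 1 - real m) (p * jadjs m c q)"
  using assms
proof (induction m arbitrary: c q)
  case (Suc m)
  have "beta_integral (A - real m) (B - real m + c) (jsteps A B (Suc m) p * q) =
      - beta_integral (A + 1 - real m) (B - real m + c) (jsteps A B m p * jadj c q)"
    using Suc.prems beta_integral_jstep_mult[of "A - real m" "B - real m" c "jsteps A B m p" q]
    by (simp add: algebra_simps)
  also have "\<dots> = - beta_integral (A + 1) (B - real m + c) (p * jadjs m (c - 1) (jadj c q))"
    using Suc.IH[of "c - 1" "jadj c q"] Suc.prems by (simp add: algebra_simps)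
  also have "\<dots> = beta_integral (A + 1) (B - real m + c) (p * jadjs (Suc m) c q)"
    using beta_integral_smult[of "A + 1" "B - real m + c" "-1"] by simp
  finally show ?case by (simp add: algebra_simps)
qed simp

lemma degree_jadj_le: "degree (jadj c q) \<le> degree q"
proof -
  have "degree ([:1, -1:] * pderiv q) \<le> degree q"
  proof (cases "degree q = 0")
    case True then show ?thesis by (metis pderiv_eq_0_iff mult_zero_right degree_0 le0)
  next
    case False
    then show ?thesis using degree_mult_le[of "[:1, -1:]" "pderiv q"] by (simp add: degree_pderiv)
  qed
  then show ?thesis unfolding jadj_def by (intro degree_diff_le) (auto intro: degree_smult_le)
qed

lemma degree_jadjs_le: "degree (jadjs m c q) \<le> degree q"
proof (induction m arbitrary: c q)
  case (Suc m)
  show ?case using order.trans[OF Suc[of "c - 1" "jadj c q"] degree_jadj_le] by simp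
qed simp

lemma jadj_0 [simp]: "jadj c 0 = 0"
  by (simp add: jadj_def)

lemma jadjs_0 [simp]: "jadjs m c 0 = 0"
  by (induction m arbitrary: c) auto

text \<open>The powers of 1-t cancel, so that \<open>q\<close> itself is differentiated; the new
  power compensates the prefactor (1-t)^(-i-1).\<close>

lemma jadj_power_mult:
  "jadj (- real i) ([:1, -1:] ^ i * q) = [:1, -1:] ^ Suc i * pderiv q"
proof (cases i)
  case 0 then show ?thesis by (simp add: jadj_def)
next
  case (Suc k)
  define L where "L = [:1, -1 :: real:]"
  define M where "M = L ^ Suc k"
  have M: "M = L * L ^ k" by (simp add: M_def)
  have D: "pderiv M = - smult (real i) (L ^ k)"
    by (simp add: L_def M_def Suc pderiv_power_Suc pderiv_pCons del: power_Suc of_nat_Suc)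
  have "jadj (- real i) (M * q) = L * M * pderiv q"
    by (simp add: jadj_def L_def[symmetric] pderiv_mult D del: mult_pCons_left)
       (simp add: M algebra_simps)
  then show ?thesis by (simp add: M_def L_def Suc del: mult_pCons_left)
qed

text \<open>In effect \<open>m\<close> ordinary derivatives of a polynomial of degree below
  \<open>m\<close>. The case of interest is \<open>i = 0\<close>, but \<open>c\<close> falls by one
  at each step, so the induction carries a power of 1-t.\<close>

lemma jadjs_power_eq_0:
  assumes "degree q < m"
  shows "jadjs m (- real i) ([:1, -1:] ^ i * q) = 0"
  using assms
proof (induction m arbitrary: i q)
  case (Suc m)
  have "jadjs m (- real (Suc i)) ([:1, -1:] ^ Suc i * pderiv q) = 0"
  proof (cases "degree q = 0")
    case True then have "pderiv q = 0" by (simp add: pderiv_eq_0_iff)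
    then show ?thesis by simp
  next
    case False
    then show ?thesis using Suc.prems by (intro Suc.IH) (simp add: degree_pderiv)
  qed
  moreover have "- real (Suc i) = - real i - 1" by simp
  ultimately show ?case using jadj_power_mult[of i q] by (simp only: jadjs.simps)
qed simp

lemma jadjs_eq_0: "degree q < m \<Longrightarrow> jadjs m 0 q = 0"
  using jadjs_power_eq_0[of q m 0] by simp

lemma degree_jstep:
  assumes "p \<noteq> 0" "A + B + real (degree p) \<noteq> 0"
  shows "degree (jstep A B p) = Suc (degree p)"
proof (rule antisym)
  \<comment> \<open>At \<open>k = Suc (degree p)\<close> this is \<open>- (A + B + degree p)\<close>
    times the leading coefficient of \<open>p\<close>.\<close>
  have c: "coeff (jstep A B p) k = A * coeff p k + real k * coeff p k
      - (if k = 0 then 0 else (A + B + real (k - 1)) * coeff p (k - 1))" for k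
    by (cases k; cases "k - 1")
       (auto simp: jstep_def coeff_pCons coeff_pderiv algebra_simps split: nat.splits)
  show "degree (jstep A B p) \<le> Suc (degree p)"
    by (rule degree_le) (auto simp: c coeff_eq_0)
  show "Suc (degree p) \<le> degree (jstep A B p)"
    using assms by (intro le_degree) (simp add: c coeff_eq_0)
qed

text \<open>After i steps \<open>A + B\<close> has dropped by 2i and the degree has grown by i, so
  the quantity that must not vanish is \<open>A + B + degree p\<close> minus i; the last step, i =
  m-1, is the critical one.\<close>

lemma degree_jsteps:
  assumes "p \<noteq> 0" "A + B + real (degree p) > real m - 1"
  shows "degree (jsteps A B m p) = degree p + m" "jsteps A B m p \<noteq> 0"
proof -
  have "degree (jsteps A B m p) = degree p + m \<and> jsteps A B m p \<noteq> 0"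
    using assms
  proof (induction m)
    case (Suc m)
    then have "degree (jsteps A B m p) = degree p + m" "jsteps A B m p \<noteq> 0" by auto
    then have "degree (jsteps A B (Suc m) p) = Suc (degree p + m)"
      using Suc.prems degree_jstep[of "jsteps A B m p" "A - real m" "B - real m"] by simp
    then show ?case by (metis add_Suc_right degree_0 nat.distinct(1))
  qed simp
  then show "degree (jsteps A B m p) = degree p + m" "jsteps A B m p \<noteq> 0" by auto
qed

section \<open>The Rodrigues formula\<close>

text \<open>Serves to rewrite under \<open>deriv\<close> with identities that hold only on
  (0,1).\<close>

lemma funpow_deriv_cong:
  assumes "open S" "t \<in> S" "\<And>u. u \<in> S \<Longrightarrow> f u = g u"
  shows "(deriv ^^ m) f t = (deriv ^^ m) g t"
  using \<open>t \<in> S\<close>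
proof (induction m arbitrary: t)
  case (Suc m)
  have "eventually (\<lambda>u. (deriv ^^ m) f u = (deriv ^^ m) g u) (nhds t)"
    using Suc assms(1) by (intro eventually_nhds_in_open[THEN eventually_mono]) auto
  then show ?case by (simp add: deriv_cong_ev)
qed (use assms in auto)

lemma jstep_has_derivative:
  assumes "0 < t" "t < 1"
  shows "((\<lambda>u. u powr A * (1 - u) powr B * poly p u) has_real_derivative
          t powr (A - 1) * (1 - t) powr (B - 1) * poly (jstep A B p) t) (at t)"
proof -
  have "t powr A = t powr (A - 1) * t" "(1 - t) powr B = (1 - t) powr (B - 1) * (1 - t)"
    using assms powr_add[of t "A - 1" 1] powr_add[of "1 - t" "B - 1" 1] by auto
  then show ?thesis
    using assms
    by (auto intro!: derivative_eq_intros simp: jstep_def simp del: mult_pCons_left)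
       (simp add: algebra_simps)
qed

lemma funpow_deriv_jsteps:
  assumes "0 < t" "t < 1"
  shows "(deriv ^^ m) (\<lambda>u. u powr A * (1 - u) powr B * poly p u) t =
         t powr (A - real m) * (1 - t) powr (B - real m) * poly (jsteps A B m p) t"
  using assms
proof (induction m arbitrary: t)
  case (Suc m)
  have "(deriv ^^ Suc m) (\<lambda>u. u powr A * (1 - u) powr B * poly p u) t =
      deriv (\<lambda>t. t powr (A - real m) * (1 - t) powr (B - real m) * poly (jsteps A B m p) t) t"
    using Suc eventually_nhds_in_open[of "{0<..<1}" t]
    by (auto intro!: deriv_cong_ev elim: eventually_mono)
  also have "\<dots> = t powr (A - real (Suc m)) * (1 - t) powr (B - real (Suc m)) * poly (jsteps A B (Suc m) p) t"
    using jstep_has_derivative[OF Suc.prems, of "A - real m" "B - real m" "jsteps A B m p"]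
    by (intro DERIV_imp_deriv) (simp add: algebra_simps)
  finally show ?case .
qed simp

text \<open>The exponents before differentiation are \<open>\<alpha> + K\<close> and
  \<open>g + m\<close>; after \<open>m\<close> derivatives and division by the weight only t^(K-m)
  is left of them.\<close>

lemma rodrigues_op_power_poly:
  assumes "0 < t" "t < 1" "m \<le> K" "\<And>u. 0 < u \<Longrightarrow> u < 1 \<Longrightarrow> f u = u ^ K * poly h u"
  shows "rodrigues_op \<alpha> g m f t = t ^ (K - m) * poly (jsteps (\<alpha> + real K) (g + real m) m h) t"
proof -
  have "(deriv ^^ m) (\<lambda>u. jp_weight \<alpha> g u * (1 - u) ^ m * f u) t =
      (deriv ^^ m) (\<lambda>u. u powr (\<alpha> + real K) * (1 - u) powr (g + real m) * poly h u) t"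
    using assms
    by (intro funpow_deriv_cong[where S = "{0<..<1}"]) (auto simp: jp_weight_def powr_add powr_realpow)
  also have "\<dots> = t powr \<alpha> * t ^ (K - m) * (1 - t) powr g *
      poly (jsteps (\<alpha> + real K) (g + real m) m h) t"
    using assms by (subst funpow_deriv_jsteps) (simp_all add: powr_add powr_diff powr_realpow power_diff)
  finally show ?thesis
    using assms by (simp add: rodrigues_op_def jp_weight_def)
qed

lemma mi_abs_Suc: "mi_abs (Suc r) k = mi_abs r k + k (Suc r)"
  by (simp add: mi_abs_def)

text \<open>The starting power \<open>N\<close> is kept apart from \<open>mi_abs r k\<close>, which
  changes with \<open>r\<close> in the induction. The power of t not yet used up counts as part of
  the weight.\<close>

lemma rodrigues_fold_poly:
  fixes \<gamma> :: "nat \<Rightarrow> real"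
  assumes "\<alpha> > -1" "\<And>l. l \<in> {1..r} \<Longrightarrow> \<gamma> l > -1" "mi_abs r k \<le> N"
  shows "\<exists>h. degree h = mi_abs r k \<and> h \<noteq> 0 \<and>
    (\<forall>t\<in>{0<..<1}. fold (\<lambda>l. rodrigues_op \<alpha> (\<gamma> l) (k l)) [1..<Suc r] (\<lambda>t. t ^ N) t =
       t ^ (N - mi_abs r k) * poly h t) \<and>
    (\<forall>l\<in>{1..r}. \<forall>q. degree q < k l \<longrightarrow>
       beta_integral (\<alpha> + real (N - mi_abs r k) + 1) (\<gamma> l + 1) (h * q) = 0)"
  using assms(2,3)
proof (induction r)
  case 0
  show ?case by (rule exI[of _ 1]) (simp add: mi_abs_def)
next
  case (Suc r)
  define m K where "m = k (Suc r)" and "K = N - mi_abs r k"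
  have K: "N - mi_abs (Suc r) k = K - m" "m \<le> K"
    using Suc.prems(2) by (auto simp: mi_abs_Suc m_def K_def)
  obtain h where h: "degree h = mi_abs r k" "h \<noteq> 0"
    "\<And>t. 0 < t \<Longrightarrow> t < 1 \<Longrightarrow>
       fold (\<lambda>l. rodrigues_op \<alpha> (\<gamma> l) (k l)) [1..<Suc r] (\<lambda>t. t ^ N) t = t ^ K * poly h t"
    "\<And>l q. l \<in> {1..r} \<Longrightarrow> degree q < k l \<Longrightarrow> beta_integral (\<alpha> + real K + 1) (\<gamma> l + 1) (h * q) = 0"
    using Suc.IH Suc.prems by (force simp: mi_abs_Suc K_def)
  define h' where "h' = jsteps (\<alpha> + real K) (\<gamma> (Suc r) + real m) m h"
  have g: "\<gamma> (Suc r) > -1" using Suc.prems by auto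
  have "degree h' = degree h + m \<and> h' \<noteq> 0"
  \<comment> \<open>If \<open>m > 0\<close> then \<open>K \<ge> 1\<close>, which gives the
    hypothesis of \<open>degree_jsteps\<close>. If \<open>m = 0\<close> that hypothesis may fail,
    but no derivative is taken.\<close>
  proof (cases "m = 0")
    case True
    then show ?thesis using h by (simp add: h'_def)
  next
    case False
    then show ?thesis using h g K assms(1) degree_jsteps[of h m "\<alpha> + real K" "\<gamma> (Suc r) + real m"]
      by (auto simp: h'_def)
  qed
  moreover have "fold (\<lambda>l. rodrigues_op \<alpha> (\<gamma> l) (k l)) [1..<Suc (Suc r)] (\<lambda>t. t ^ N) t =
      t ^ (K - m) * poly h' t" if "0 < t" "t < 1" for t
    using rodrigues_op_power_poly[OF that K(2) h(3), of \<alpha> "\<gamma> (Suc r)"]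
    by (simp add: m_def h'_def)
  moreover have "beta_integral (\<alpha> + real (K - m) + 1) (\<gamma> l + 1) (h' * q) = 0"
    if l: "l \<in> {1..Suc r}" and q: "degree q < k l" for l q
  proof -
    \<comment> \<open>The weight of index \<open>l\<close> is that of index \<open>Suc r\<close>
      times (1-t)^c, so the operator is moved onto (1-t)^c q.\<close>
    define c where "c = \<gamma> l - \<gamma> (Suc r)"
    have "\<gamma> l > -1" using l Suc.prems by auto
    then have "beta_integral (\<alpha> + real (K - m) + 1) (\<gamma> l + 1) (h' * q) =
        beta_integral (\<alpha> + real K + 1) (\<gamma> l + 1) (h * jadjs m c q)"
      using beta_integral_jsteps_mult[of m "\<alpha> + real K" "\<gamma> (Suc r) + real m" c h q] K assms(1)
      by (simp add: h'_def c_def of_nat_diff algebra_simps)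
    also have "\<dots> = 0"
    proof (cases "l = Suc r")
      case True
      then show ?thesis using q by (simp add: c_def m_def jadjs_eq_0)
    next
      case False
      then show ?thesis
        using l q h(4)[of l "jadjs m c q"] degree_jadjs_le[of m c q] by auto
    qed
    finally show ?thesis .
  qed
  ultimately show ?case
    using h(1) unfolding K(1) by (intro exI[of _ h']) (auto simp: mi_abs_Suc m_def simp del: upt_Suc)
qed

lemma set_integral_Icc_eq_Ioo:
  fixes f :: "real \<Rightarrow> 'a::{banach, second_countable_topology}"
  assumes "f \<in> borel_measurable borel"
  shows "(LINT t:{a..b}|lborel. f t) = (LINT t:{a<..<b}|lborel. f t)"
proof (rule set_integral_cong_set)
  show "set_borel_measurable lborel {a..b} f" "set_borel_measurable lborel {a<..<b} f"
    using assms by (auto intro: set_borel_measurable_borel)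
  show "AE x in lborel. (x \<in> {a<..<b}) = (x \<in> {a..b})"
    using AE_lborel_singleton[of a] AE_lborel_singleton[of b] by eventually_elim auto
qed

lemma jp_integral_eq_beta_integral:
  "(LINT t:{0..1}|lborel. poly p t * t ^ s * jp_weight \<alpha> g t) =
   beta_integral (\<alpha> + 1) (g + 1) (p * monom 1 s)"
proof -
  have "(\<lambda>t. poly p t * t ^ s * jp_weight \<alpha> g t) \<in> borel_measurable borel"
    unfolding jp_weight_def by measurable
  then have "(LINT t:{0..1}|lborel. poly p t * t ^ s * jp_weight \<alpha> g t) =
      (LINT t:{0<..<1}|lborel. poly p t * t ^ s * jp_weight \<alpha> g t)"
    by (rule set_integral_Icc_eq_Ioo)
  also have "\<dots> = beta_integral (\<alpha> + 1) (g + 1) (p * monom 1 s)"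
    unfolding beta_integral_def by (simp add: jp_weight_def poly_monom mult_ac)
  finally show ?thesis .
qed

text \<open>Existence comes from \<open>rodrigues_fold_poly\<close>; uniqueness, needed for
  \<open>THE\<close>, holds because a polynomial is determined by its values on (0,1).\<close>

lemma is_jacobi_pineiro_jacobi_pineiro:
  fixes \<gamma> :: "nat \<Rightarrow> real"
  assumes "\<alpha> > -1" "\<And>l. l \<in> {1..r} \<Longrightarrow> \<gamma> l > -1"
  shows "is_jacobi_pineiro r \<alpha> \<gamma> k (jacobi_pineiro r \<alpha> \<gamma> k)"
proof -
  let ?P = "\<lambda>p. is_jacobi_pineiro r \<alpha> \<gamma> k p \<and> (\<forall>t\<in>{0<..<1}. poly p t = rodrigues r \<alpha> \<gamma> k t)"
  obtain h where h: "degree h = mi_abs r k"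
    "\<And>t. t \<in> {0<..<1} \<Longrightarrow> rodrigues r \<alpha> \<gamma> k t = poly h t"
    "\<And>l q. l \<in> {1..r} \<Longrightarrow> degree q < k l \<Longrightarrow> beta_integral (\<alpha> + 1) (\<gamma> l + 1) (h * q) = 0"
    using rodrigues_fold_poly[of \<alpha> r \<gamma> k "mi_abs r k", OF assms order.refl]
    unfolding rodrigues_def by (auto simp del: upt_Suc)
  have "is_jacobi_pineiro r \<alpha> \<gamma> k h"
    unfolding is_jacobi_pineiro_def jp_integral_eq_beta_integral
    using h by (auto simp: degree_monom_eq)
  then have "?P h" using h by auto
  moreover have "q = h" if "?P q" for q
  proof -
    have "{0<..<1} \<subseteq> {t. poly (q - h) t = 0}" using that h by auto
    then have "infinite {t. poly (q - h) t = 0}"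
      by (rule infinite_super) (simp add: infinite_Ioo)
    then show ?thesis using poly_roots_finite[of "q - h"] by auto
  qed
  ultimately show ?thesis
    unfolding jacobi_pineiro_def by (rule theI2) auto
qed

section \<open>Radial and rotation invariant integrals over the disk\<close>

definition to_complex :: "real \<times> real \<Rightarrow> complex" where
  "to_complex v = Complex (fst v) (snd v)"

lemma norm_to_complex: "cmod (to_complex v) = norm v"
  by (cases v) (simp add: to_complex_def cmod_def norm_Pair)

lemma to_complex_simps [simp]: "Re (to_complex v) = fst v" "Im (to_complex v) = snd v"
  by (simp_all add: to_complex_def)

lemma disk_eq_cball: "disk = cball 0 1"
  by (auto simp: disk_def norm_Pair)

lemma mem_disk_iff: "v \<in> disk \<longleftrightarrow> (norm v)\<^sup>2 \<in> {0..1}"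
  using abs_square_le_1[of "norm v"] by (simp add: disk_eq_cball)

lemma disk_borel [measurable]: "disk \<in> sets borel"
  by (simp add: disk_eq_cball)

section \<open>The squared norm as radial variable\<close>

lemma emeasure_lborel_disc:
  assumes "0 \<le> x"
  shows "emeasure lborel {v::real \<times> real. (norm v)\<^sup>2 \<le> x} = ennreal (pi * x)"
proof -
  have "(norm v)\<^sup>2 \<le> x \<longleftrightarrow> norm v \<le> sqrt x" for v :: "real \<times> real"
    using real_sqrt_le_iff[of "(norm v)\<^sup>2" x] by simp
  then have "{v::real \<times> real. (norm v)\<^sup>2 \<le> x} = cball 0 (sqrt x)"
    by (simp add: cball_def)
  moreover have "unit_ball_vol 2 = pi"
    by (simp add: eval_unit_ball_vol)
  ultimately show ?thesis
    using assms emeasure_cball[of "sqrt x" "0 :: real \<times> real"] by simp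
qed

text \<open>Replaces polar coordinates: the disc of squared radius x has area \<open>pi * x\<close>,
  so the squared radius has constant density. The measures are compared on half-lines.\<close>

lemma distr_disk_norm_square:
  "distr (restrict_space lborel disk) borel (\<lambda>v. (norm v)\<^sup>2) =
   density lborel (\<lambda>t. ennreal (pi * indicator {0..1} t))" (is "?M = ?N")
proof (rule measure_eqI_lessThan)
  define D where "D = (\<lambda>x. {v::real \<times> real. (norm v)\<^sup>2 \<le> x})"
  have n: "(\<lambda>v::real \<times> real. (norm v)\<^sup>2) \<in> borel_measurable borel" by measurable
  have D [measurable]: "D x \<in> sets borel" for x
    unfolding D_def using n by measurable
  have eD: "emeasure lborel (D x) = ennreal (pi * x)" if "0 \<le> x" for x
    using emeasure_lborel_disc[OF that] by (simp add: D_def)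
  \<comment> \<open>Clamping \<open>x\<close> to [0,1] covers the half-lines that contain [0,1] or
    miss it.\<close>
  have M: "emeasure ?M {x<..} = ennreal (pi * (1 - min 1 (max 0 x)))" for x :: real
  proof -
    have "emeasure ?M {x<..} = emeasure (restrict_space lborel disk) ((\<lambda>v. (norm v)\<^sup>2) -` {x<..} \<inter> disk)"
      using n by (subst emeasure_distr) (simp_all add: measurable_restrict_space1 space_restrict_space)
    also have "\<dots> = emeasure lborel ((\<lambda>v. (norm v)\<^sup>2) -` {x<..} \<inter> disk)"
      by (rule emeasure_restrict_space) auto
    also have "(\<lambda>v. (norm v)\<^sup>2) -` {x<..} \<inter> disk = D 1 - D (min 1 x)"
      by (auto simp: D_def mem_disk_iff)
    also have "emeasure lborel (D 1 - D (min 1 x)) = ennreal (pi * (1 - min 1 (max 0 x)))"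
    proof (cases "x < 0")
      case True
      then have "D (min 1 x) = {}"
        by (auto simp: D_def not_le intro: less_le_trans)
      moreover have "min 1 (max 0 x) = 0" using True by simp
      ultimately show ?thesis by (simp add: eD)
    next
      case False
      have "emeasure lborel (D 1 - D (min 1 x)) = emeasure lborel (D 1) - emeasure lborel (D (min 1 x))"
        using False by (intro emeasure_Diff) (auto simp: eD, auto simp: D_def)
      also have "\<dots> = ennreal (pi * 1 - pi * min 1 x)"
        using False by (simp only: eD zero_le_one min_def split: if_splits) (auto simp: eD ennreal_minus)
      finally show ?thesis using False by (simp add: algebra_simps max_def)
    qed
    finally show ?thesis .
  qed
  show "emeasure ?M {x<..} < \<infinity>" for x unfolding M by simp
  show "emeasure ?M {x<..} = emeasure ?N {x<..}" for x
  proof -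
    have "emeasure ?N {x<..} = (\<integral>\<^sup>+t. ennreal (pi * indicator {0..1} t) * indicator {x<..} t \<partial>lborel)"
      by (rule emeasure_density) auto
    also have "\<dots> = (\<integral>\<^sup>+t. ennreal pi * indicator ({0..1} \<inter> {x<..}) t \<partial>lborel)"
      by (intro nn_integral_cong) (auto simp: indicator_def)
    also have "\<dots> = ennreal pi * emeasure lborel ({0..1} \<inter> {x<..})"
      by (rule nn_integral_cmult_indicator) auto
    also have "{0..1} \<inter> {x<..} = (if x < 0 then {0..1} else {x<..1})"
      by auto
    also have "emeasure lborel (if x < 0 then {0..1} else {x<..1}) = ennreal (1 - min 1 (max 0 x))"
      by (auto simp: min_def max_def)
    finally show ?thesis unfolding M by (simp add: ennreal_mult)
  qed
qed auto

lemma disk_radial: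
  fixes g :: "real \<Rightarrow> real"
  assumes [measurable]: "g \<in> borel_measurable borel"
  shows "set_integrable lborel disk (\<lambda>v. g ((norm v)\<^sup>2)) \<longleftrightarrow> set_integrable lborel {0..1} g"
    and "(LINT v:disk|lborel. g ((norm v)\<^sup>2)) = pi * (LINT t:{0..1}|lborel. g t)"
proof -
  let ?M = "restrict_space lborel disk" and ?n = "\<lambda>v::real \<times> real. (norm v)\<^sup>2"
  have n [measurable]: "?n \<in> measurable ?M borel"
    by (intro measurable_restrict_space1) measurable
  have eq: "pi * indicat_real {0..1} t * g t = pi * (indicat_real {0..1} t *\<^sub>R g t)" for t
    by simp
  have "set_integrable lborel disk (\<lambda>v. g (?n v)) \<longleftrightarrow> integrable ?M (\<lambda>v. g (?n v))"
    by (simp add: set_integrable_def integrable_restrict_space)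
  also have "\<dots> \<longleftrightarrow> integrable (distr ?M borel ?n) g"
    by (simp add: integrable_distr_eq)
  also have "\<dots> \<longleftrightarrow> set_integrable lborel {0..1} g"
    unfolding distr_disk_norm_square
    by (subst integrable_real_density) (auto simp: eq set_integrable_def)
  finally show "set_integrable lborel disk (\<lambda>v. g (?n v)) \<longleftrightarrow> set_integrable lborel {0..1} g" .
  have "(LINT v:disk|lborel. g (?n v)) = (LINT v|?M. g (?n v))"
    by (simp add: set_lebesgue_integral_def integral_restrict_space)
  also have "\<dots> = (LINT t|distr ?M borel ?n. g t)"
    by (simp add: integral_distr)
  also have "\<dots> = pi * (LINT t:{0..1}|lborel. g t)"
    unfolding distr_disk_norm_square
    by (subst integral_real_density) (auto simp: eq set_lebesgue_integral_def)
  finally show "(LINT v:disk|lborel. g (?n v)) = pi * (LINT t:{0..1}|lborel. g t)" .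
qed

section \<open>Rotation invariance of plane Lebesgue measure\<close>

text \<open>By Tonelli: with one coordinate fixed, a shear translates the other.\<close>

lemma nn_integral_lborel_shear:
  fixes f :: "real \<times> real \<Rightarrow> ennreal"
  assumes [measurable]: "f \<in> borel_measurable borel"
  shows "(\<integral>\<^sup>+v. f (fst v + c * snd v, snd v) \<partial>lborel) = (\<integral>\<^sup>+v. f v \<partial>lborel)"
    and "(\<integral>\<^sup>+v. f (fst v, snd v + c * fst v) \<partial>lborel) = (\<integral>\<^sup>+v. f v \<partial>lborel)"
proof -
  have trans: "(\<integral>\<^sup>+x. g (x + t) \<partial>lborel) = (\<integral>\<^sup>+x. g x \<partial>lborel)"
    if "g \<in> borel_measurable borel" for g and t :: real
    using nn_integral_real_affine[OF that, of 1 t] by (simp add: add.commute)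
  have f [measurable]: "f \<in> borel_measurable (lborel \<Otimes>\<^sub>M lborel)"
    by (simp add: lborel_prod)
  have "(\<lambda>v::real \<times> real. (fst v + c * snd v, snd v)) \<in> borel_measurable borel"
     "(\<lambda>v::real \<times> real. (fst v, snd v + c * fst v)) \<in> borel_measurable borel"
    by (intro borel_measurable_continuous_onI continuous_intros)+
  then have m: "(\<lambda>v. f (fst v + c * snd v, snd v)) \<in> borel_measurable (lborel \<Otimes>\<^sub>M lborel)"
    "(\<lambda>v. f (fst v, snd v + c * fst v)) \<in> borel_measurable (lborel \<Otimes>\<^sub>M lborel)"
    using assms by (auto simp: lborel_prod intro: measurable_compose)
  show "(\<integral>\<^sup>+v. f (fst v + c * snd v, snd v) \<partial>lborel) = (\<integral>\<^sup>+v. f v \<partial>lborel)"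
  proof -
    have "(\<integral>\<^sup>+v. f (fst v + c * snd v, snd v) \<partial>(lborel \<Otimes>\<^sub>M lborel)) =
        (\<integral>\<^sup>+y. \<integral>\<^sup>+x. f (x + c * y, y) \<partial>lborel \<partial>lborel)"
      using lborel_pair.nn_integral_snd[OF m(1)] by simp
    also have "\<dots> = (\<integral>\<^sup>+y. \<integral>\<^sup>+x. f (x, y) \<partial>lborel \<partial>lborel)"
      by (intro nn_integral_cong trans) measurable
    also have "\<dots> = (\<integral>\<^sup>+v. f v \<partial>(lborel \<Otimes>\<^sub>M lborel))"
      by (rule lborel_pair.nn_integral_snd) measurable
    finally show ?thesis by (simp add: lborel_prod)
  qed
  show "(\<integral>\<^sup>+v. f (fst v, snd v + c * fst v) \<partial>lborel) = (\<integral>\<^sup>+v. f v \<partial>lborel)"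
  proof -
    have "(\<integral>\<^sup>+v. f (fst v, snd v + c * fst v) \<partial>(lborel \<Otimes>\<^sub>M lborel)) =
        (\<integral>\<^sup>+x. \<integral>\<^sup>+y. f (x, y + c * x) \<partial>lborel \<partial>lborel)"
      using lborel.nn_integral_fst[OF m(2)] by simp
    also have "\<dots> = (\<integral>\<^sup>+x. \<integral>\<^sup>+y. f (x, y) \<partial>lborel \<partial>lborel)"
      by (intro nn_integral_cong trans) measurable
    also have "\<dots> = (\<integral>\<^sup>+v. f v \<partial>(lborel \<Otimes>\<^sub>M lborel))"
      by (rule lborel.nn_integral_fst) measurable
    finally show ?thesis by (simp add: lborel_prod)
  qed
qed

definition rotate2 :: "real \<Rightarrow> real \<times> real \<Rightarrow> real \<times> real" where
  "rotate2 \<phi> v = (fst v * cos \<phi> - snd v * sin \<phi>, fst v * sin \<phi> + snd v * cos \<phi>)"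

lemma borel_measurable_rotate2 [measurable]: "rotate2 \<phi> \<in> borel_measurable borel"
  unfolding rotate2_def by (intro borel_measurable_continuous_onI continuous_intros)

lemma to_complex_rotate2: "to_complex (rotate2 \<phi> v) = cis \<phi> * to_complex v"
  by (simp add: complex_eq_iff rotate2_def algebra_simps)

lemma norm_rotate2: "norm (rotate2 \<phi> v) = norm v"
  by (metis to_complex_rotate2 norm_to_complex norm_mult norm_cis mult_1)

text \<open>A rotation by \<open>\<phi>\<close> is the product of three shears with parameters
  \<open>- tan (\<phi>/2)\<close>, \<open>sin \<phi>\<close>, \<open>- tan (\<phi>/2)\<close>.\<close>

lemma lborel_distr_rotate2:
  assumes "cos (\<phi> / 2) \<noteq> 0"
  shows "distr lborel borel (rotate2 \<phi>) = lborel"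
proof (rule measure_eqI)
  fix A assume "A \<in> sets (distr lborel borel (rotate2 \<phi>))"
  then have A [measurable]: "A \<in> sets borel" by simp
  define c where "c = - tan (\<phi> / 2)"
  have s: "sin \<phi> = 2 * sin (\<phi> / 2) * cos (\<phi> / 2)" and co: "cos \<phi> = 2 * (cos (\<phi> / 2))\<^sup>2 - 1"
    using sin_double[of "\<phi> / 2"] cos_double_cos[of "\<phi> / 2"] by simp_all
  \<comment> \<open>The diagonal and the upper right entry of the product of the three shears; the
    lower left one is \<open>sin \<phi>\<close>.\<close>
  have cs: "1 + c * sin \<phi> = cos \<phi>" "c + c * cos \<phi> = - sin \<phi>"
    using assms sin_cos_squared_add[of "\<phi> / 2"]
    by (auto simp: c_def tan_def s co power2_eq_square field_simps) (simp add: distrib_left[symmetric])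
  define f where "f = (\<lambda>v. indicator A v :: ennreal)"
  define g where "g = (\<lambda>v. f (fst v + c * snd v, snd v))"
  define h where "h = (\<lambda>v. g (fst v, snd v + sin \<phi> * fst v))"
  have f [measurable]: "f \<in> borel_measurable borel" unfolding f_def by measurable
  have m: "(\<lambda>v::real \<times> real. (fst v + c * snd v, snd v)) \<in> borel_measurable borel"
     "(\<lambda>v::real \<times> real. (fst v, snd v + sin \<phi> * fst v)) \<in> borel_measurable borel"
    by (intro borel_measurable_continuous_onI continuous_intros)+
  have g: "g \<in> borel_measurable borel"
    unfolding g_def using measurable_compose[OF m(1) f] .
  have h: "h \<in> borel_measurable borel"
    unfolding h_def using measurable_compose[OF m(2) g] .
  have "h (fst v + c * snd v, snd v) = f (rotate2 \<phi> v)" for v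
  proof -
    have 1: "snd v + sin \<phi> * (fst v + c * snd v) = fst v * sin \<phi> + snd v * cos \<phi>"
      unfolding cs(1)[symmetric] by (simp add: algebra_simps)
    have "fst v + c * snd v + c * (fst v * sin \<phi> + snd v * cos \<phi>) =
        fst v * (1 + c * sin \<phi>) + snd v * (c + c * cos \<phi>)"
      by (simp add: algebra_simps)
    then have "fst v + c * snd v + c * (fst v * sin \<phi> + snd v * cos \<phi>) = fst v * cos \<phi> - snd v * sin \<phi>"
      by (simp add: cs)
    with 1 show ?thesis by (simp add: h_def g_def rotate2_def)
  qed
  then have "(\<integral>\<^sup>+v. f (rotate2 \<phi> v) \<partial>lborel) = (\<integral>\<^sup>+v. h (fst v + c * snd v, snd v) \<partial>lborel)"
    by simp
  also have "\<dots> = (\<integral>\<^sup>+v. f v \<partial>lborel)"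
    using nn_integral_lborel_shear(1)[OF h, of c] nn_integral_lborel_shear(2)[OF g, of "sin \<phi>"]
      nn_integral_lborel_shear(1)[OF f, of c] by (simp add: h_def g_def)
  finally have "(\<integral>\<^sup>+v. f v \<partial>distr lborel borel (rotate2 \<phi>)) = (\<integral>\<^sup>+v. f v \<partial>lborel)"
    by (simp add: nn_integral_distr)
  then show "emeasure (distr lborel borel (rotate2 \<phi>)) A = emeasure lborel A"
    by (simp add: f_def)
qed simp

lemma disk_integral_rotate2:
  fixes F :: "real \<times> real \<Rightarrow> 'a::{banach, second_countable_topology}"
  assumes [measurable]: "F \<in> borel_measurable borel" and "cos (\<phi> / 2) \<noteq> 0"
  shows "(LINT v:disk|lborel. F (rotate2 \<phi> v)) = (LINT v:disk|lborel. F v)"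
proof -
  have [measurable]: "(\<lambda>v. indicat_real disk v *\<^sub>R F v) \<in> borel_measurable borel"
    by (intro borel_measurable_scaleR borel_measurable_indicator) auto
  have "(LINT v:disk|lborel. F v) = (LINT v|distr lborel borel (rotate2 \<phi>). indicat_real disk v *\<^sub>R F v)"
    by (simp add: lborel_distr_rotate2 assms set_lebesgue_integral_def)
  also have "\<dots> = (LINT v|lborel. indicat_real disk (rotate2 \<phi> v) *\<^sub>R F (rotate2 \<phi> v))"
    by (rule integral_distr) measurable
  also have "\<dots> = (LINT v:disk|lborel. F (rotate2 \<phi> v))"
    by (simp add: set_lebesgue_integral_def disk_eq_cball indicator_def norm_rotate2)
  finally show ?thesis by simp
qed

lemma set_integrable_Icc_iff_Ioo:
  fixes f :: "real \<Rightarrow> real"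
  assumes [measurable]: "f \<in> borel_measurable borel"
  shows "set_integrable lborel {a..b} f \<longleftrightarrow> set_integrable lborel {a<..<b} f"
  unfolding set_integrable_def
proof (rule integrable_cong_AE)
  show "AE t in lborel. indicator {a..b} t *\<^sub>R f t = indicator {a<..<b} t *\<^sub>R f t"
    using AE_lborel_singleton[of a] AE_lborel_singleton[of b]
    by eventually_elim (auto simp: indicator_def)
qed measurable

lemma disk_radial_mult_integrable:
  fixes F :: "real \<times> real \<Rightarrow> 'a::{banach, second_countable_topology}"
  assumes [measurable]: "g \<in> borel_measurable borel" "F \<in> borel_measurable borel"
    and g: "set_integrable lborel {0..1} g" and F: "\<And>v. norm v \<le> 1 \<Longrightarrow> norm (F v) \<le> 1"
  shows "set_integrable lborel disk (\<lambda>v. g ((norm v)\<^sup>2) *\<^sub>R F v)"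
proof (rule set_integrable_bound)
  show "set_integrable lborel disk (\<lambda>v. g ((norm v)\<^sup>2))"
    using g by (simp add: disk_radial)
  show "set_borel_measurable lborel disk (\<lambda>v. g ((norm v)\<^sup>2) *\<^sub>R F v)"
    by (rule set_borel_measurable_borel) measurable
  show "AE v in lborel. v \<in> disk \<longrightarrow> norm (g ((norm v)\<^sup>2) *\<^sub>R F v) \<le> norm (g ((norm v)\<^sup>2))"
    using F by (intro AE_I2) (auto simp: disk_eq_cball intro: mult_left_le)
qed

section \<open>Complex moments of a radial weight\<close>

text \<open>The mixed form allows the factors x and y to be traded for z and its conjugate one at a
  time.\<close>

definition disk_monomial :: "nat \<Rightarrow> nat \<Rightarrow> nat \<Rightarrow> nat \<Rightarrow> real \<times> real \<Rightarrow> complex" where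
  "disk_monomial p q a b v = to_complex v ^ p * cnj (to_complex v) ^ q * of_real (fst v ^ a * snd v ^ b)"

lemma borel_measurable_disk_monomial [measurable]: "disk_monomial p q a b \<in> borel_measurable borel"
proof -
  have "disk_monomial p q a b = (\<lambda>v. (of_real (fst v) + \<i> * of_real (snd v)) ^ p *
      (of_real (fst v) - \<i> * of_real (snd v)) ^ q * of_real (fst v ^ a * snd v ^ b))"
  proof
    fix v
    have "to_complex v = of_real (fst v) + \<i> * of_real (snd v)" "cnj (to_complex v) = of_real (fst v) - \<i> * of_real (snd v)"
      by (auto simp: complex_eq_iff)
    then show "disk_monomial p q a b v = (of_real (fst v) + \<i> * of_real (snd v)) ^ p *
      (of_real (fst v) - \<i> * of_real (snd v)) ^ q * of_real (fst v ^ a * snd v ^ b)"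
      by (simp only: disk_monomial_def)
  qed
  moreover have "\<dots> \<in> borel_measurable borel"
    by (intro borel_measurable_continuous_onI continuous_intros)
  ultimately show ?thesis by (simp only:)
qed

lemma abs_coord_le_norm: "\<bar>fst v\<bar> \<le> norm v" "\<bar>snd v\<bar> \<le> norm (v :: real \<times> real)"
  using norm_fst_le[of "fst v" "snd v"] norm_snd_le[of "snd v" "fst v"] by auto

lemma norm_disk_monomial_le: "norm v \<le> 1 \<Longrightarrow> norm (disk_monomial p q a b v) \<le> 1"
proof -
  assume "norm v \<le> 1"
  moreover from this have "\<bar>fst v\<bar> \<le> 1" "\<bar>snd v\<bar> \<le> 1"
    using abs_coord_le_norm[of v] by linarith+
  ultimately show ?thesis
    by (simp add: disk_monomial_def norm_mult norm_power norm_to_complex mult_le_one power_le_one)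
qed

lemma disk_monomial_Suc:
  "disk_monomial p q (Suc a) b v = (1/2) * disk_monomial (Suc p) q a b v + (1/2) * disk_monomial p (Suc q) a b v"
  "disk_monomial p q a (Suc b) v = (-\<i>/2) * disk_monomial (Suc p) q a b v + (\<i>/2) * disk_monomial p (Suc q) a b v"
proof -
  have x: "of_real (fst v) = (to_complex v + cnj (to_complex v)) / 2"
    by (auto simp: complex_eq_iff)
  have y: "of_real (snd v) = (- \<i>) * (to_complex v - cnj (to_complex v)) / 2"
    by (auto simp: complex_eq_iff)
  show "disk_monomial p q (Suc a) b v = (1/2) * disk_monomial (Suc p) q a b v + (1/2) * disk_monomial p (Suc q) a b v"
    unfolding disk_monomial_def power_Suc of_real_mult x by (simp add: field_simps)
  show "disk_monomial p q a (Suc b) v = (-\<i>/2) * disk_monomial (Suc p) q a b v + (\<i>/2) * disk_monomial p (Suc q) a b v"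
    unfolding disk_monomial_def power_Suc of_real_mult y by (simp add: field_simps)
qed

definition disk_moment ::
    "(real \<Rightarrow> real) \<Rightarrow> nat \<Rightarrow> nat \<Rightarrow> nat \<Rightarrow> nat \<Rightarrow> complex" where
  "disk_moment g p q a b = (LINT v:disk|lborel. g ((norm v)\<^sup>2) *\<^sub>R disk_monomial p q a b v)"

context
  fixes g :: "real \<Rightarrow> real"
  assumes gm [measurable]: "g \<in> borel_measurable borel" and gi: "set_integrable lborel {0..1} g"
begin

lemma disk_monomial_integrable: "set_integrable lborel disk (\<lambda>v. g ((norm v)\<^sup>2) *\<^sub>R disk_monomial p q a b v)"
  by (intro disk_radial_mult_integrable gm gi norm_disk_monomial_le borel_measurable_disk_monomial)

lemma disk_moment_lincomb:
  assumes "\<And>v. disk_monomial p q a b v = c * disk_monomial p1 q1 a1 b1 v + d * disk_monomial p2 q2 a2 b2 v"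
  shows "disk_moment g p q a b = c * disk_moment g p1 q1 a1 b1 + d * disk_moment g p2 q2 a2 b2"
proof -
  have "disk_moment g p q a b = (LINT v:disk|lborel. c * (g ((norm v)\<^sup>2) *\<^sub>R disk_monomial p1 q1 a1 b1 v) +
      d * (g ((norm v)\<^sup>2) *\<^sub>R disk_monomial p2 q2 a2 b2 v))"
    unfolding disk_moment_def by (simp add: assms scaleR_add_right)
  also have "\<dots> = (LINT v:disk|lborel. c * (g ((norm v)\<^sup>2) *\<^sub>R disk_monomial p1 q1 a1 b1 v)) +
      (LINT v:disk|lborel. d * (g ((norm v)\<^sup>2) *\<^sub>R disk_monomial p2 q2 a2 b2 v))"
    by (intro set_integral_add(2) set_integrable_mult_right disk_monomial_integrable)
  also have "\<dots> = c * disk_moment g p1 q1 a1 b1 + d * disk_moment g p2 q2 a2 b2"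
    by (simp only: set_integral_mult_right disk_moment_def)
  finally show ?thesis .
qed

text \<open>Induction on the number of coordinate factors left: trading one raises \<open>p\<close>
  or \<open>q\<close> by one, so these vary in the induction.\<close>

lemma disk_moment_eq_0:
  assumes "\<And>i i'. i + i' = a + b \<Longrightarrow> disk_moment g (p + i) (q + i') 0 0 = 0"
  shows "disk_moment g p q a b = 0"
  using assms
proof (induction "a + b" arbitrary: a b p q)
  case 0
  from 0(2)[of 0 0] 0(1) show ?case by simp
next
  case (Suc N)
  have prems: "disk_moment g (p + i) (q + i') 0 0 = 0" if "i + i' = Suc N" for i i'
    using Suc.prems Suc.hyps(2) that by metis
  have IH: "disk_moment g (Suc p) q a' b' = 0" "disk_moment g p (Suc q) a' b' = 0"
    if N: "N = a' + b'" for a' b'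
  proof -
    show "disk_moment g (Suc p) q a' b' = 0"
    proof (rule Suc.hyps(1)[OF N])
      fix i i' assume "i + i' = a' + b'"
      then show "disk_moment g (Suc p + i) (q + i') 0 0 = 0"
        using prems[of "Suc i" i'] N by simp
    qed
    show "disk_moment g p (Suc q) a' b' = 0"
    proof (rule Suc.hyps(1)[OF N])
      fix i i' assume "i + i' = a' + b'"
      then show "disk_moment g (p + i) (Suc q + i') 0 0 = 0"
        using prems[of i "Suc i'"] N by simp
    qed
  qed
  show ?case
  proof (cases a)
    case a: (Suc a')
    then have "N = a' + b" using Suc.hyps(2) by simp
    then show ?thesis
      unfolding a using disk_moment_lincomb[OF disk_monomial_Suc(1), of p q a' b] IH[of a' b] by simp
  next
    case 0
    then obtain b' where b: "b = Suc b'" "N = a + b'" using Suc.hyps(2) by (cases b) auto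
    then show ?thesis
      unfolding b(1) using disk_moment_lincomb[OF disk_monomial_Suc(2), of p q a b'] IH[of a b'] by simp
  qed
qed

lemma disk_moment_off_diagonal:
  assumes "p \<noteq> q"
  shows "disk_moment g p q 0 0 = 0"
proof -
  define d where "d = real p - real q"
  \<comment> \<open>The rotation then multiplies the monomial by \<open>\<i>\<close>, which forces
    the moment to be 0. A factor -1, from the angle \<open>pi / d\<close>, would violate
    \<open>cos (\<phi> / 2) \<noteq> 0\<close> when \<open>d\<close> is 1 or -1.\<close>
  define \<phi> where "\<phi> = pi / (2 * d)"
  have d: "\<bar>d\<bar> \<ge> 1" "d \<noteq> 0" using assms by (auto simp: d_def)
  have "\<bar>\<phi> / 2\<bar> < pi / 2"
    using d by (auto simp: \<phi>_def abs_mult field_simps)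
  then have "- (pi / 2) < \<phi> / 2" "\<phi> / 2 < pi / 2" by linarith+
  then have c: "cos (\<phi> / 2) \<noteq> 0"
    using cos_gt_zero_pi by (metis less_irrefl)
  have "cis \<phi> ^ p * cnj (cis \<phi>) ^ q = cis (\<phi> * d)"
    by (simp only: cis_cnj Complex.DeMoivre cis_mult) (simp add: d_def algebra_simps)
  also have "\<dots> = \<i>" using d by (simp add: \<phi>_def)
  finally have i: "cis \<phi> ^ p * cnj (cis \<phi>) ^ q = \<i>" .
  have "disk_monomial p q 0 0 (rotate2 \<phi> v) = (cis \<phi> ^ p * cnj (cis \<phi>) ^ q) * disk_monomial p q 0 0 v" for v
    by (simp only: disk_monomial_def to_complex_rotate2 complex_cnj_mult power_mult_distrib power_0 mult_ac)
  then have "disk_monomial p q 0 0 (rotate2 \<phi> v) = \<i> * disk_monomial p q 0 0 v" for v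
    by (simp only: i)
  then have "\<i> * disk_moment g p q 0 0 = (LINT v:disk|lborel. g ((norm (rotate2 \<phi> v))\<^sup>2) *\<^sub>R disk_monomial p q 0 0 (rotate2 \<phi> v))"
    unfolding disk_moment_def by (simp add: norm_rotate2 flip: set_integral_mult_right)
  also have "\<dots> = disk_moment g p q 0 0"
    unfolding disk_moment_def by (rule disk_integral_rotate2[OF _ c]) measurable
  finally show ?thesis by (auto simp: complex_eq_iff)
qed

text \<open>The monomial is the \<open>p\<close>-th power of the squared norm, so
  \<open>disk_radial\<close> applies.\<close>

lemma disk_moment_diagonal: "disk_moment g p p 0 0 = of_real (pi * (LINT t:{0<..<1}|lborel. g t * t ^ p))"
proof -
  have "disk_monomial p p 0 0 v = of_real (((norm v)\<^sup>2) ^ p)" for v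
  proof -
    have "to_complex v * cnj (to_complex v) = of_real ((norm v)\<^sup>2)"
      by (metis complex_norm_square norm_to_complex)
    then show ?thesis by (simp add: disk_monomial_def flip: power_mult_distrib)
  qed
  then have "disk_moment g p p 0 0 = (LINT v:disk|lborel. complex_of_real (g ((norm v)\<^sup>2) * ((norm v)\<^sup>2) ^ p))"
    unfolding disk_moment_def by (simp add: scaleR_conv_of_real)
  also have "\<dots> = of_real (LINT v:disk|lborel. g ((norm v)\<^sup>2) * ((norm v)\<^sup>2) ^ p)"
    by (rule set_integral_complex_of_real)
  also have "(LINT v:disk|lborel. g ((norm v)\<^sup>2) * ((norm v)\<^sup>2) ^ p) = pi * (LINT t:{0..1}|lborel. g t * t ^ p)"
    using disk_radial(2)[of "\<lambda>t. g t * t ^ p"] by simp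
  finally show ?thesis by (simp add: set_integral_Icc_eq_Ioo)
qed

end

section \<open>Orthogonality on the disk\<close>

text \<open>De Moivre's formula, valid at the origin too since \<open>rcis_cmod_Arg\<close> holds
  there.\<close>

lemma disk_mop_eq:
  assumes "M = mi_abs r n - 2 * mi_abs r j"
  shows "disk_mop r \<mu> n j \<nu> (fst v) (snd v) = poly (jacobi_pineiro r (real M) \<mu> j) ((norm v)\<^sup>2) *
    (if \<nu> = 1 then Re (to_complex v ^ M) else Im (to_complex v ^ M))"
proof -
  have "to_complex v ^ M = rcis (cmod (to_complex v) ^ M) (real M * Arg (to_complex v))"
    by (metis rcis_cmod_Arg DeMoivre2)
  then show ?thesis
    by (simp add: disk_mop_def disk_mop_polar_def assms[symmetric] Let_def norm_to_complex to_complex_def[symmetric])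
qed

text \<open>Integrability is part of the conclusion because a nonintegrable function has integral 0
  by convention, so the vanishing alone would say less.\<close>

theorem proposition5:
  fixes r :: nat and \<mu> :: "nat \<Rightarrow> real" and n j :: "nat \<Rightarrow> nat" and \<nu> :: nat
  assumes mu_gt: "\<And>l. l \<in> {1..r} \<Longrightarrow> \<mu> l > -1"
    and mu_diff: "\<And>i i'. i \<in> {1..r} \<Longrightarrow> i' \<in> {1..r} \<Longrightarrow> i \<noteq> i' \<Longrightarrow> \<mu> i - \<mu> i' \<notin> \<int>"
    and j_le: "2 * mi_abs r j \<le> mi_abs r n"
    and nu: "\<nu> \<in> {1, 2}"
    and nu2: "\<nu> = 2 \<Longrightarrow> 2 * mi_abs r j < mi_abs r n"
  shows "\<forall>l\<in>{1..r}. \<forall>a b :: nat.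
      set_integrable lborel disk
        (\<lambda>(x, y). disk_mop r \<mu> n j \<nu> x y * x ^ a * y ^ b * disk_weight (\<mu> l) x y) \<and>
      (a + b < mi_abs r n - 2 * mi_abs r j + 2 * j l \<longrightarrow>
        (LINT (x, y):disk|lborel.
           disk_mop r \<mu> n j \<nu> x y * x ^ a * y ^ b * disk_weight (\<mu> l) x y) = 0) \<and>
      (odd (int (a + b) - int (mi_abs r n) + 2 * int (mi_abs r j)) \<longrightarrow>
        (LINT (x, y):disk|lborel.
           disk_mop r \<mu> n j \<nu> x y * x ^ a * y ^ b * disk_weight (\<mu> l) x y) = 0)"
proof (intro ballI allI)
  fix l a b assume l: "l \<in> {1..r}"
  define M where "M = mi_abs r n - 2 * mi_abs r j"
  define P where "P = jacobi_pineiro r (real M) \<mu> j"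
  define g where "g = (\<lambda>t. poly P t * ((\<mu> l + 1) / pi * (1 - t) powr \<mu> l))"
  have ml: "\<mu> l > -1" using mu_gt l .
  have P: "is_jacobi_pineiro r (real M) \<mu> j P"
    unfolding P_def using mu_gt by (intro is_jacobi_pineiro_jacobi_pineiro) auto
  have gm [measurable]: "g \<in> borel_measurable borel"
    unfolding g_def by measurable
  \<comment> \<open>The first Beta parameter is 1, as \<open>g\<close> contains no power of t;
    \<open>t powr 0\<close> is 1 on the open interval.\<close>
  have "set_integrable lborel {0<..<1} (\<lambda>t. (\<mu> l + 1) / pi * (t powr (1 - 1) * (1 - t) powr ((\<mu> l + 1) - 1) * poly P t))"
    using ml by (intro set_integrable_mult_right beta_weight_poly_integrable) auto
  also have "?this \<longleftrightarrow> set_integrable lborel {0<..<1} g"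
    by (intro set_integrable_cong) (auto simp: g_def)
  finally have gi: "set_integrable lborel {0..1} g"
    by (simp add: set_integrable_Icc_iff_Ioo)
  define I where "I = disk_moment g M 0 a b"
  \<comment> \<open>Real and imaginary part both commute with the integral, so the two values of
    \<open>\<nu>\<close> are treated together.\<close>
  define R where "R = (if \<nu> = 1 then Re else Im)"
  have R: "bounded_linear R"
    by (simp add: R_def bounded_linear_Re bounded_linear_Im)
  define f where "f = (\<lambda>(x, y). disk_mop r \<mu> n j \<nu> x y * x ^ a * y ^ b * disk_weight (\<mu> l) x y)"
  have f: "f v = R (g ((norm v)\<^sup>2) *\<^sub>R disk_monomial M 0 a b v)" for v
  proof -
    have "disk_weight (\<mu> l) (fst v) (snd v) = (\<mu> l + 1) / pi * (1 - (norm v)\<^sup>2) powr \<mu> l"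
      by (cases v) (simp add: disk_weight_def norm_Pair algebra_simps)
    then show ?thesis
      unfolding f_def case_prod_unfold disk_mop_eq[OF M_def] P_def[symmetric]
      by (simp add: g_def disk_monomial_def R_def)
  qed
  have int: "integrable lborel (\<lambda>v. indicat_real disk v *\<^sub>R (g ((norm v)\<^sup>2) *\<^sub>R disk_monomial M 0 a b v))"
    using disk_monomial_integrable[OF gm gi] unfolding set_integrable_def .
  have ind: "indicat_real disk v *\<^sub>R f v = R (indicat_real disk v *\<^sub>R (g ((norm v)\<^sup>2) *\<^sub>R disk_monomial M 0 a b v))" for v
    unfolding f by (simp add: R_def)
  have fi: "set_integrable lborel disk f"
    unfolding set_integrable_def ind by (rule integrable_bounded_linear[OF R int])
  have fI: "(LINT v:disk|lborel. f v) = R I"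
    unfolding set_lebesgue_integral_def ind I_def disk_moment_def
    by (rule integral_bounded_linear[OF R int])
  \<comment> \<open>Of t^(M+i), the factor t^M belongs to the Jacobi-Pineiro weight with parameter
    \<open>M\<close>, and t^i is the test power.\<close>
  have diag: "disk_moment g (M + i) (M + i) 0 0 = 0" if "i < j l" for i
  proof -
    have "(LINT t:{0<..<1}|lborel. g t * t ^ (M + i)) =
        (LINT t:{0<..<1}|lborel. (\<mu> l + 1) / pi * (poly P t * t ^ i * jp_weight (real M) (\<mu> l) t))"
      by (intro set_lebesgue_integral_cong) (auto simp: g_def jp_weight_def powr_realpow power_add)
    also have "\<dots> = (\<mu> l + 1) / pi * (LINT t:{0..1}|lborel. poly P t * t ^ i * jp_weight (real M) (\<mu> l) t)"
    proof -
      have "(\<lambda>t. poly P t * t ^ i * jp_weight (real M) (\<mu> l) t) \<in> borel_measurable borel"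
        unfolding jp_weight_def by measurable
      from set_integral_Icc_eq_Ioo[OF this, of 0 1] show ?thesis by simp
    qed
    also have "\<dots> = 0" using P l that by (simp add: is_jacobi_pineiro_def)
    finally show ?thesis by (simp add: disk_moment_diagonal[OF gm gi])
  qed
  \<comment> \<open>The common criterion for both claims: a surviving term has i' = M + i, which
    with i + i' = a + b means a + b = M + 2i.\<close>
  have "I = 0" if "\<And>i. a + b = M + 2 * i \<Longrightarrow> i < j l"
    unfolding I_def
  proof (rule disk_moment_eq_0[OF gm gi])
    fix i i' :: nat assume i: "i + i' = a + b"
    show "disk_moment g (M + i) (0 + i') 0 0 = 0"
    proof (cases "M + i = i'")
      case True
      then show ?thesis using diag[of i] that[of i] i by simp
    next
      case False
      then show ?thesis by (simp add: disk_moment_off_diagonal[OF gm gi])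
    qed
  qed
  then have zero: "(LINT v:disk|lborel. f v) = 0" if "\<And>i. a + b = M + 2 * i \<Longrightarrow> i < j l"
    using that fI by (simp add: R_def)
  have "(LINT v:disk|lborel. f v) = 0" if "a + b < M + 2 * j l"
    using that by (intro zero) auto
  moreover have "(LINT v:disk|lborel. f v) = 0"
    if "odd (int (a + b) - int (mi_abs r n) + 2 * int (mi_abs r j))"
  proof (rule zero)
    fix i assume "a + b = M + 2 * i"
    \<comment> \<open>The even value contradicts oddness, so the bound on \<open>i\<close> holds
      vacuously.\<close>
    then have "int (a + b) - int (mi_abs r n) + 2 * int (mi_abs r j) = 2 * int i"
      using j_le by (simp add: M_def of_nat_diff)
    then show "i < j l" using that by simp
  qed
  ultimately show "set_integrable lborel disk
        (\<lambda>(x, y). disk_mop r \<mu> n j \<nu> x y * x ^ a * y ^ b * disk_weight (\<mu> l) x y) \<and>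
      (a + b < mi_abs r n - 2 * mi_abs r j + 2 * j l \<longrightarrow>
        (LINT (x, y):disk|lborel.
           disk_mop r \<mu> n j \<nu> x y * x ^ a * y ^ b * disk_weight (\<mu> l) x y) = 0) \<and>
      (odd (int (a + b) - int (mi_abs r n) + 2 * int (mi_abs r j)) \<longrightarrow>
        (LINT (x, y):disk|lborel.
           disk_mop r \<mu> n j \<nu> x y * x ^ a * y ^ b * disk_weight (\<mu> l) x y) = 0)"
    using fi unfolding f_def M_def by blast
qed

end
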